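(* Let $\gamma_0$ be the $L$-shape arc and let $\{z_{n,k}^*\}_{k=0}^n\subset\gamma_0$ be the family of Fejér points on $\gamma_0$ (both defined in the context). Then for every $1<p<\infty$, $$\limsup_{n\to\infty}\ \max_{P_n\in\Pi_n,\ P_n\not\equiv0}\ \frac{\int_{\gamma_0}|P_n(z)|^p\,|dz|}{\sum_{k=0}^n|P_n(z_{n,k}^* )|^p\,\mathrm{dist}(z_{n,k}^*,\Gamma_n)}=\infty .$$
   Context: $\Pi_n$ is the space of complex polynomials of degree $\le n$, and $|dz|$ denotes arc length. The arc: $\gamma_0=\{(-1+i)x: x\in[0,27^{1/4}/\sqrt2]\}\cup\{(-1-i)x: x\in[0,27^{1/4}/\sqrt2]\}\subset\mathbb C$. The exterior conformal map of $\{|w|>1\}$ onto $\mathbb C\setminus\gamma_0$ is $\psi_0(w)=\left(w-\frac1w\right)\left(\frac{w-1}{w+1}\right)^{1/2}$, with the branch of the square root that tends to $1$ as $w\to\infty$; it is extended continuously to $|w|=1$, and the extension maps $|w|=1$ onto $\gamma_0$. Angles: for $0\le k\le\lfloor n/2\rfloor$, $\theta_{n,k}=\frac{2k\pi}{n+1}$ if $n$ is even and $\theta_{n,k}=\frac{(2k+1)\pi}{n+1}$ if $n$ is odd; for $\lfloor n/2\rfloor<k\le n$, $\theta_{n,k}=-\theta_{n,\,2\lfloor n/2\rfloor+1-k}$. Fejér points: $z_{n,k}^*=\psi_0(e^{i\theta_{n,k}})$, $k=0,\dots,n$. Level curves: $\Gamma_n=\{\psi_0(w): |w|=1+\frac1{n+1}\}$,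 and $\mathrm{dist}(z,\Gamma_n)$ is the Euclidean distance from $z$ to $\Gamma_n$. *)

theory Defs
  imports "HOL-Complex_Analysis.Complex_Analysis"
begin

definition gamma0 :: "complex set" where
  "gamma0 = {(-1 + \<i>) * of_real x | x :: real. 0 \<le> x \<and> x \<le> 27 powr (1/4) / sqrt 2}
          \<union> {(-1 - \<i>) * of_real x | x :: real. 0 \<le> x \<and> x \<le> 27 powr (1/4) / sqrt 2}"

definition gamma0_path :: "real \<Rightarrow> complex" where
  "gamma0_path = linepath ((-1 + \<i>) * of_real (27 powr (1/4) / sqrt 2)) 0
               +++ linepath 0 ((-1 - \<i>) * of_real (27 powr (1/4) / sqrt 2))"

lemma path_image_gamma0_path: "path_image gamma0_path = gamma0"
proof -
  define L :: real where "L = 27 powr (1/4) / sqrt 2"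
  have L: "L > 0" by (simp add: L_def)
  have seg: "closed_segment 0 (c * of_real L) = {c * of_real x | x :: real. 0 \<le> x \<and> x \<le> L}"
    for c :: complex
  proof (intro equalityI subsetI)
    fix z assume "z \<in> closed_segment 0 (c * of_real L)"
    then obtain u where u: "0 \<le> u" "u \<le> 1" "z = u *\<^sub>R (c * of_real L)"
      by (auto simp: in_segment)
    have "z = c * of_real (u * L)" using u by (simp add: scaleR_conv_of_real)
    moreover have "0 \<le> u * L" "u * L \<le> L" using u L by (auto simp: mult_left_le_one_le)
    ultimately show "z \<in> {c * of_real x | x :: real. 0 \<le> x \<and> x \<le> L}" by blast
  next
    fix z assume "z \<in> {c * of_real x | x :: real. 0 \<le> x \<and> x \<le> L}"
    then obtain x where x: "0 \<le> x" "x \<le> L" "z = c * of_real x" by blast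
    have "z = (x / L) *\<^sub>R (c * of_real L)" using x L by (simp add: scaleR_conv_of_real)
    moreover have "0 \<le> x / L" "x / L \<le> 1" using x L by auto
    ultimately show "z \<in> closed_segment 0 (c * of_real L)"
      unfolding in_segment by (intro exI[of _ "x / L"]) auto
  qed
  have "path_image gamma0_path
      = closed_segment 0 ((-1 + \<i>) * of_real L) \<union> closed_segment 0 ((-1 - \<i>) * of_real L)"
    unfolding gamma0_path_def L_def [symmetric]
    by (simp add: path_image_join closed_segment_commute)
  then show ?thesis
    unfolding gamma0_def L_def [symmetric] by (simp only: seg)
qed

lemma arc_gamma0_path: "arc gamma0_path"
proof -
  define L :: real where "L = 27 powr (1/4) / sqrt 2"
  have L: "L > 0" by (simp add: L_def)
  have "closed_segment ((-1 + \<i>) * of_real L) 0 \<inter> closed_segment 0 ((-1 - \<i>) * of_real L) \<subseteq> {0}"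
  proof
    fix z assume "z \<in> closed_segment ((-1 + \<i>) * of_real L) 0 \<inter> closed_segment 0 ((-1 - \<i>) * of_real L)"
    then have "\<exists>u. u \<le> 1 \<and> z = (1 - u) *\<^sub>R ((-1 + \<i>) * of_real L)"
      and "\<exists>v. 0 \<le> v \<and> z = v *\<^sub>R ((-1 - \<i>) * of_real L)"
      unfolding Int_iff in_segment scaleR_zero_right add_0_left add_0_right by blast+
    then obtain u v where u: "u \<le> 1" "z = (1 - u) *\<^sub>R ((-1 + \<i>) * of_real L)"
      and v: "0 \<le> v" "z = v *\<^sub>R ((-1 - \<i>) * of_real L)"
      by blast
    have "(1 - u) * L = Im z" using u(2) by simp
    moreover have "Im z = - (v * L)" using v(2) by simp
    moreover have "(1 - u) * L \<ge> 0" "v * L \<ge> 0" using u(1) v(1) L by auto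
    ultimately have "v * L = 0" by linarith
    then show "z \<in> {0}" using v(2) L by simp
  qed
  then show ?thesis
    unfolding gamma0_path_def L_def [symmetric]
    using L by (intro arc_join arc_linepath) (auto simp: complex_eq_iff)
qed

definition arclength_integral :: "(real \<Rightarrow> complex) \<Rightarrow> (complex \<Rightarrow> real) \<Rightarrow> real" where
  "arclength_integral g f =
     integral {0..1} (\<lambda>t. f (g t) * norm (vector_derivative g (at t within {0..1})))"

text \<open>
  For \<open>|w| > 1\<close> the quotient \<open>(w - 1) / (w + 1)\<close> lies in the open right half-plane, and
  for \<open>|w| = 1\<close>, \<open>w \<noteq> -1\<close>, on the imaginary axis, so the principal square root is the
  branch that tends to 1 at infinity. At \<open>w = -1\<close> the convention \<open>x / 0 = 0\<close>
  gives the value 0, which is the continuous extension.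
\<close>

definition psi0 :: "complex \<Rightarrow> complex" where
  "psi0 w = (w - 1 / w) * csqrt ((w - 1) / (w + 1))"

lemma psi0_branch: "((\<lambda>w. csqrt ((w - 1) / (w + 1))) \<longlongrightarrow> 1) at_infinity"
proof -
  have "((\<lambda>w::complex. 1 - 2 * inverse (w + 1)) \<longlongrightarrow> 1 - 2 * 0) at_infinity"
    by (intro tendsto_diff tendsto_mult tendsto_const filterlim_compose[OF tendsto_inverse_0]
          tendsto_add_filterlim_at_infinity'[OF filterlim_ident tendsto_const])
  moreover have "\<forall>\<^sub>F w::complex in at_infinity. 1 - 2 * inverse (w + 1) = (w - 1) / (w + 1)"
    unfolding eventually_at_infinity
  proof (intro exI[of _ 2] allI impI)
    fix w :: complex assume "2 \<le> norm w"
    then have "w + 1 \<noteq> 0" by (auto simp: add_eq_0_iff2)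
    then show "1 - 2 * inverse (w + 1) = (w - 1) / (w + 1)" by (simp add: field_simps)
  qed
  ultimately have "((\<lambda>w::complex. (w - 1) / (w + 1)) \<longlongrightarrow> 1) at_infinity"
    by (simp add: tendsto_cong)
  then have "((\<lambda>w. csqrt ((w - 1) / (w + 1))) \<longlongrightarrow> csqrt 1) at_infinity"
    by (rule isCont_tendsto_compose[rotated]) (auto intro!: continuous_at_csqrt)
  then show ?thesis by simp
qed

lemma continuous_on_psi0: "continuous_on {w. 1 \<le> norm w} psi0"
proof (rule continuous_on_eq_continuous_within[THEN iffD2], intro ballI)
  fix w :: complex assume "w \<in> {w. 1 \<le> norm w}"
  then have w: "1 \<le> norm w" by simp
  then have w0: "w \<noteq> 0" by auto
  show "continuous (at w within {w. 1 \<le> norm w}) psi0"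
  proof (cases "w = -1")
    case False
    then have w1: "w + 1 \<noteq> 0" by (simp add: add_eq_0_iff2)
    have "(w - 1) / (w + 1) = (w - 1) * cnj (w + 1) / of_real ((norm (w + 1))\<^sup>2)"
      using complex_div_cnj[of "w - 1" "w + 1"] unfolding of_real_power .
    then have "Re ((w - 1) / (w + 1)) = Re ((w - 1) * cnj (w + 1)) / (norm (w + 1))\<^sup>2"
      by (simp only: Re_divide_of_real)
    also have "Re ((w - 1) * cnj (w + 1)) = (norm w)\<^sup>2 - 1"
      unfolding cmod_power2 by (simp add: power2_eq_square algebra_simps)
    finally have "Re ((w - 1) / (w + 1)) = ((norm w)\<^sup>2 - 1) / (norm (w + 1))\<^sup>2" .
    then have re: "0 \<le> Re ((w - 1) / (w + 1))" using w by simp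
    have "w = 1 \<or> (w - 1) / (w + 1) \<notin> \<real>\<^sub>\<le>\<^sub>0"
    proof (rule disjCI)
      assume "\<not> (w - 1) / (w + 1) \<notin> \<real>\<^sub>\<le>\<^sub>0"
      then have "Re ((w - 1) / (w + 1)) = 0" "Im ((w - 1) / (w + 1)) = 0"
        using re unfolding complex_nonpos_Reals_iff by linarith+
      then have "(w - 1) / (w + 1) = 0" by (simp only: complex_eq_iff zero_complex.sel)
      then show "w = 1" using w1 by simp
    qed
    then show ?thesis
    proof
      assume "w = 1"
      have cont: "isCont (\<lambda>w::complex. (w - 1 / w)) 1" "isCont (\<lambda>w::complex. (w - 1) / (w + 1)) 1"
        by (intro continuous_intros; simp)+
      have "isCont (\<lambda>w. cmod (w - 1 / w) * sqrt (cmod ((w - 1) / (w + 1)))) 1"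
        by (intro continuous_intros cont; simp)
      then have "((\<lambda>w. cmod (w - 1 / w) * sqrt (cmod ((w - 1) / (w + 1)))) \<longlongrightarrow> 0) (at 1)"
        by (simp add: isCont_def)
      then have "(psi0 \<longlongrightarrow> 0) (at 1)"
        by (intro tendsto_norm_zero_cancel[of psi0]) (simp add: psi0_def norm_mult)
      then have "isCont psi0 1" by (simp add: isCont_def psi0_def)
      then show ?thesis using \<open>w = 1\<close> continuous_at_imp_continuous_at_within by blast
    next
      assume "(w - 1) / (w + 1) \<notin> \<real>\<^sub>\<le>\<^sub>0"
      then show ?thesis
        unfolding psi0_def using w0 w1 
        by (intro continuous_intros continuous_within_compose2[of _ _ "\<lambda>w. (w - 1) / (w + 1)" csqrt]
              continuous_at_imp_continuous_at_within[OF continuous_at_csqrt]) auto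
    qed
  next
    case True
    have eq: "norm (psi0 z) = sqrt (cmod ((z - 1) ^ 3 * (z + 1))) / cmod z" if "z \<noteq> 0" for z
    proof (cases "z = -1")
      case False
      then have z1: "cmod (z + 1) \<noteq> 0" by (simp add: add_eq_0_iff2)
      have zz: "z - 1 / z = (z - 1) * (z + 1) / z"
        using that by (simp add: field_simps)
      have "norm (psi0 z) = cmod ((z - 1) * (z + 1) / z) * sqrt (cmod ((z - 1) / (z + 1)))"
        unfolding psi0_def zz by (simp add: norm_mult norm_divide)
      also have "\<dots> = sqrt ((cmod ((z - 1) * (z + 1)))\<^sup>2 * cmod ((z - 1) / (z + 1))) / cmod z"
        by (simp only: real_sqrt_mult real_sqrt_abs abs_norm_cancel norm_divide times_divide_eq_left)
      also have "(cmod ((z - 1) * (z + 1)))\<^sup>2 * cmod ((z - 1) / (z + 1))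
               = cmod ((z - 1) ^ 3 * (z + 1))"
        using z1 by (simp add: norm_divide norm_mult norm_power power2_eq_square power3_eq_cube)
      finally show ?thesis .
    qed (simp add: psi0_def)
    have "isCont (\<lambda>z. sqrt (cmod ((z - 1) ^ 3 * (z + 1))) / cmod z) (-1)"
      by (intro continuous_intros; simp)
    then have "((\<lambda>z. sqrt (cmod ((z - 1) ^ 3 * (z + 1))) / cmod z) \<longlongrightarrow> 0) (at (-1))"
      by (simp add: isCont_def)
    moreover have "\<forall>\<^sub>F z in at (-1). sqrt (cmod ((z - 1) ^ 3 * (z + 1))) / cmod z = norm (psi0 z)"
      using eventually_neq_at_within[of 0 "-1::complex" UNIV] by eventually_elim (simp add: eq)
    ultimately have "((\<lambda>z. norm (psi0 z)) \<longlongrightarrow> 0) (at (-1))"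
      by (simp add: tendsto_cong)
    then have "(psi0 \<longlongrightarrow> 0) (at (-1))" by (rule tendsto_norm_zero_cancel)
    then have "isCont psi0 (-1)" by (simp add: isCont_def psi0_def)
    then show ?thesis using True continuous_at_imp_continuous_at_within by blast
  qed
qed

definition theta_upper :: "nat \<Rightarrow> nat \<Rightarrow> real" where
  "theta_upper n k =
     (if even n then 2 * real k * pi / (real n + 1) else (2 * real k + 1) * pi / (real n + 1))"

definition theta :: "nat \<Rightarrow> nat \<Rightarrow> real" where
  "theta n k =
     (if k \<le> n div 2 then theta_upper n k else - theta_upper n (2 * (n div 2) + 1 - k))"

definition fejer :: "nat \<Rightarrow> nat \<Rightarrow> complex" where
  "fejer n k = psi0 (cis (theta n k))"

definition level_curve :: "nat \<Rightarrow> complex set" where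
  "level_curve n = {psi0 w | w. norm w = 1 + 1 / (real n + 1)}"

text \<open>
  The quotients are taken in \<^typ>\<open>ennreal\<close>, where a positive number divided by 0
  is \<open>\<infinity>\<close>; the numerator is positive for every nonzero polynomial.
  The maximum of the quotients is their supremum together with its being attained.
\<close>

definition mz_quotient :: "real \<Rightarrow> nat \<Rightarrow> complex poly \<Rightarrow> ennreal" where
  "mz_quotient p n P =
     ennreal (arclength_integral gamma0_path (\<lambda>z. norm (poly P z) powr p)) /
     ennreal (\<Sum>k=0..n. norm (poly P (fejer n k)) powr p * infdist (fejer n k) (level_curve n))"

definition mz_quotients :: "real \<Rightarrow> nat \<Rightarrow> ennreal set" where
  "mz_quotients p n = {mz_quotient p n P | P. degree P \<le> n \<and> P \<noteq> 0}"

end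

theory Submission
  imports Defs "HOL-Real_Asymp.Real_Asymp"
begin

text \<open>
  Let \<open>n + 1 = 3m\<close> with \<open>m\<close> odd. Then the Fejer angle \<open>\<theta>\<^sub>m = 2\<pi>/3\<close> is the critical point
  of \<open>\<psi>\<^sub>0\<close> that is mapped to an endpoint of the arc. On the upper half circle the modulus of
  \<open>\<psi>\<^sub>0\<close> is even about \<open>2\<pi>/3\<close> up to a cubic error, so the two neighbouring Fejer points
  \<open>z\<^sub>m\<^sub>-\<^sub>1\<close> and \<open>z\<^sub>m\<^sub>+\<^sub>1\<close> have distance \<open>O(n^-3)\<close>, which is much smaller than the
  distance \<open>O(n^-2)\<close> from \<open>z\<^sub>m\<^sub>-\<^sub>1\<close> to the level curve. The Lagrange polynomial that is 1 at
  \<open>z\<^sub>m\<^sub>-\<^sub>1\<close> and 0 at the other Fejer points must therefore, by Markov's inequality on the upper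
  segment, have maximum at least \<open>c n\<close> there and stay above half of it on a length \<open>c n^-2\<close>.
  Hence its quotient is at least \<open>c n^p\<close>. (If two Fejer points coincide, some nonzero polynomial
  of degree at most \<open>n\<close> vanishes at all of them and its quotient is infinite.)

  Markov's inequality (up to the constant) comes from the maximum principle for \<open>w^n q((w + 1/w)/2)\<close>
  and Cauchy's estimate on discs of radius \<open>1/(8 n^2)\<close>. That the supremum is attained follows from
  compactness of the unit sphere of coefficient vectors and homogeneity.
\<close>

section \<open>Markov's inequality\<close>

text \<open>The factor \<open>w ^ n\<close> clears the pole at 0. On the unit circle (w + 1/w)/2 is
  the real part of w, so the bound on [-1, 1] controls the boundary values and the maximum principle
  does the rest.\<close>

lemma bernstein_walsh_joukowski:
  fixes q :: "complex poly"
  assumes deg: "degree q \<le> n"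
    and bd: "\<And>x::real. \<bar>x\<bar> \<le> 1 \<Longrightarrow> norm (poly q (of_real x)) \<le> M"
    and w: "w \<noteq> 0" "norm w \<le> 1"
  shows "norm w ^ n * norm (poly q ((w + 1 / w) / 2)) \<le> M"
proof -
  define Q where "Q = (\<lambda>w::complex. \<Sum>i\<le>n. coeff q i * ((w\<^sup>2 + 1) / 2) ^ i * w ^ (n - i))"
  have Q: "Q w = w ^ n * poly q ((w + 1 / w) / 2)" if "w \<noteq> 0" for w
  proof -
    have "poly q x = (\<Sum>i\<le>n. coeff q i * x ^ i)" for x
      unfolding poly_altdef using deg
      by (intro sum.mono_neutral_left) (auto simp: coeff_eq_0)
    moreover have "((w\<^sup>2 + 1) / 2) ^ i * w ^ (n - i) = w ^ n * ((w + 1 / w) / 2) ^ i"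
      if "i \<le> n" for i
    proof -
      have "(w\<^sup>2 + 1) / 2 = w * ((w + 1 / w) / 2)"
        using \<open>w \<noteq> 0\<close> by (simp add: field_simps power2_eq_square)
      then have "((w\<^sup>2 + 1) / 2) ^ i * w ^ (n - i) = (w ^ i * w ^ (n - i)) * ((w + 1 / w) / 2) ^ i"
        by (simp only: power_mult_distrib mult_ac)
      also have "w ^ i * w ^ (n - i) = w ^ n"
        using that by (simp flip: power_add)
      finally show ?thesis .
    qed
    ultimately show ?thesis
      by (simp add: Q_def sum_distrib_left mult_ac)
  qed
  have hol: "Q holomorphic_on UNIV"
    unfolding Q_def by (intro holomorphic_intros) simp_all
  have "norm (Q w) \<le> M"
  proof (rule maximum_modulus_frontier[where S = "cball 0 1" and f = Q and \<xi> = w])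
    show "Q holomorphic_on interior (cball 0 1)" using hol by (rule holomorphic_on_subset) simp
    show "continuous_on (closure (cball 0 1)) Q"
      using holomorphic_on_imp_continuous_on[OF hol] by (rule continuous_on_subset) simp
    fix z :: complex assume "z \<in> frontier (cball 0 1)"
    then have z: "norm z = 1" by (simp add: dist_norm)
    then have "1 / z = cnj z"
      using complex_div_cnj[of 1 z] by simp
    then have "(z + 1 / z) / 2 = of_real (Re z)"
      by (simp add: complex_eq_iff)
    moreover have "\<bar>Re z\<bar> \<le> 1"
      using abs_Re_le_cmod[of z] z by simp
    moreover have "z \<noteq> 0" using z by auto
    ultimately show "norm (Q z) \<le> M"
      using Q[of z] bd z by (simp add: norm_mult norm_power)
  qed (use w in auto)
  then show ?thesis
    using Q[OF w(1)] by (simp add: norm_mult norm_power)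
qed

text \<open>The two preimages of z are the roots of X^2 - 2 z X + 1. Their product is 1, so one of
  them lies in the closed unit disc.\<close>

lemma joukowski_surj:
  obtains w :: complex where "w \<noteq> 0" "norm w \<le> 1" "z = (w + 1 / w) / 2"
proof -
  define u v where "u = z + csqrt (z\<^sup>2 - 1)" and "v = z - csqrt (z\<^sup>2 - 1)"
  have uv: "u * v = 1"
    by (simp add: u_def v_def algebra_simps flip: power2_eq_square)
  then have "u \<noteq> 0" "v \<noteq> 0" by auto
  with uv have "1 / u = v" "1 / v = u"
    by (simp_all add: divide_eq_eq mult.commute)
  moreover have z: "z = (u + v) / 2"
    by (simp add: u_def v_def)
  moreover from z have "z = (v + u) / 2"
    by (simp only: add.commute)
  moreover have "norm u \<le> 1 \<or> norm v \<le> 1"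
  proof (rule ccontr)
    assume "\<not> (norm u \<le> 1 \<or> norm v \<le> 1)"
    then have "1 * 1 < norm u * norm v" by (intro mult_strict_mono) auto
    then show False using uv by (simp flip: norm_mult)
  qed
  ultimately show ?thesis
    using that[of u] that[of v] \<open>u \<noteq> 0\<close> \<open>v \<noteq> 0\<close> by presburger
qed

text \<open>A point near [-1, 1] thus comes from a w near the unit circle. With r = |w|, the focal
  distances of the point sum to r + 1/r, those of x sum to 2, and each of them changes by at most
  the distance to x.\<close>

lemma joukowski_dist_segment:
  fixes w :: complex and x :: real
  assumes "w \<noteq> 0" "norm w \<le> 1" "\<bar>x\<bar> \<le> 1"
  shows "(1 - norm w)\<^sup>2 \<le> 2 * norm ((w + 1 / w) / 2 - of_real x)"
proof -
  define z where "z = (w + 1 / w) / 2"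
  have r: "norm w > 0" using assms by simp
  \<comment> \<open>the Joukowski image of a circle is an ellipse with foci \<open>-1\<close> and \<open>1\<close>\<close>
  have "z - 1 = (w - 1)\<^sup>2 / (2 * w)" "z + 1 = (w + 1)\<^sup>2 / (2 * w)"
    using assms(1) by (simp_all add: z_def field_simps power2_eq_square)
  then have foci: "norm (z - 1) + norm (z + 1) = ((norm (w - 1))\<^sup>2 + (norm (w + 1))\<^sup>2) / (2 * norm w)"
    by (simp add: norm_divide norm_mult norm_power add_divide_distrib)
  have "(norm (w - 1))\<^sup>2 + (norm (w + 1))\<^sup>2 = 2 * ((norm w)\<^sup>2 + 1)"
    unfolding cmod_power2 by (simp add: power2_eq_square algebra_simps)
  then have "norm (z - 1) + norm (z + 1) = ((norm w)\<^sup>2 + 1) / norm w"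
    unfolding foci by (simp only: mult_divide_mult_cancel_left)
  moreover have "norm (z - 1) \<le> norm (z - of_real x) + (1 - x)"
    using norm_triangle_ineq[of "z - of_real x" "of_real (x - 1)"] assms(3)
    unfolding norm_of_real by simp
  moreover have "norm (z + 1) \<le> norm (z - of_real x) + (1 + x)"
    using norm_triangle_ineq[of "z - of_real x" "of_real (x + 1)"] assms(3)
    unfolding norm_of_real by simp
  ultimately have "((norm w)\<^sup>2 + 1) / norm w - 2 \<le> 2 * norm (z - of_real x)"
    by linarith
  moreover have "(1 - norm w)\<^sup>2 \<le> (1 - norm w)\<^sup>2 / norm w"
    using r assms(2) by (simp add: le_divide_eq mult_left_le)
  moreover have "(1 - norm w)\<^sup>2 / norm w = ((norm w)\<^sup>2 + 1) / norm w - 2"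
    using r by (simp add: field_simps power2_eq_square)
  ultimately show ?thesis by (simp add: z_def)
qed

text \<open>The radius 1/(8 n^2) forces |w| >= 1 - 1/(2n). Bernoulli's inequality then gives |w|^n
  >= 1/2, which is the source of the factor 2.\<close>

lemma poly_growth_near_segment:
  fixes q :: "complex poly" and x :: real
  assumes deg: "degree q \<le> n" and n: "n \<ge> 1"
    and bd: "\<And>x::real. \<bar>x\<bar> \<le> 1 \<Longrightarrow> norm (poly q (of_real x)) \<le> M"
    and x: "\<bar>x\<bar> \<le> 1" and z: "norm (z - of_real x) \<le> 1 / (8 * real n ^ 2)"
  shows "norm (poly q z) \<le> 2 * M"
proof -
  obtain w where w: "w \<noteq> 0" "norm w \<le> 1" "z = (w + 1 / w) / 2"
    by (rule joukowski_surj)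
  have "(1 - norm w)\<^sup>2 \<le> 2 * norm (z - of_real x)"
    using joukowski_dist_segment[OF w(1,2) x] unfolding w(3) .
  also have "\<dots> \<le> (1 / (2 * real n))\<^sup>2"
    using z by (simp add: power2_eq_square)
  finally have "1 - norm w \<le> 1 / (2 * real n)"
    by (rule power2_le_imp_le) simp
  then have r: "norm w \<ge> 1 + (- 1 / (2 * real n))" by simp
  have "1 / 2 = 1 + real n * (- 1 / (2 * real n))"
    using n by simp
  also have "\<dots> \<le> (1 + (- 1 / (2 * real n))) ^ n"
    by (rule Bernoulli_inequality) (use n in \<open>simp add: field_simps\<close>)
  also have "\<dots> \<le> norm w ^ n"
    using r n by (intro power_mono) (auto simp: field_simps)
  finally have "1 / 2 * norm (poly q z) \<le> norm w ^ n * norm (poly q z)"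
    by (intro mult_right_mono) auto
  also have "\<dots> \<le> M"
    using bernstein_walsh_joukowski[OF deg bd w(1,2)] unfolding w(3) .
  finally show ?thesis by simp
qed

text \<open>Cauchy's estimate on a disc of radius 1/(8 n^2), where |q| <= 2 M, gives the constant 2
  * 8 = 16.\<close>

lemma markov_symmetric_interval:
  fixes q :: "complex poly" and x :: real
  assumes deg: "degree q \<le> n" and n: "n \<ge> 1"
    and bd: "\<And>x::real. \<bar>x\<bar> \<le> 1 \<Longrightarrow> norm (poly q (of_real x)) \<le> M"
    and x: "\<bar>x\<bar> \<le> 1"
  shows "norm (poly (pderiv q) (of_real x)) \<le> 16 * real n ^ 2 * M"
proof -
  have "norm ((deriv ^^ 1) (poly q) (of_real x)) \<le> fact 1 * (2 * M) / (1 / (8 * real n ^ 2)) ^ 1"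
  proof (rule Cauchy_inequality)
    fix z :: complex assume "norm (of_real x - z) = 1 / (8 * real n ^ 2)"
    then show "norm (poly q z) \<le> 2 * M"
      using poly_growth_near_segment[OF deg n bd x] by (simp add: norm_minus_commute)
  qed (use n in \<open>auto intro!: holomorphic_intros continuous_intros\<close>)
  moreover have "deriv (poly q) (of_real x) = poly (pderiv q) (of_real x)"
    by (rule DERIV_imp_deriv) (rule poly_DERIV)
  ultimately show ?thesis by (simp add: mult_ac)
qed

lemma markov_unit_interval:
  fixes q :: "complex poly" and t :: real
  assumes deg: "degree q \<le> n" and n: "n \<ge> 1"
    and bd: "\<And>t::real. t \<in> {0..1} \<Longrightarrow> norm (poly q (of_real t)) \<le> M"
    and t: "t \<in> {0..1}"
  shows "norm (poly (pderiv q) (of_real t)) \<le> 32 * real n ^ 2 * M"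
proof -
  define r where "r = pcompose q [:1/2, 1/2:]"
  have "norm (poly (pderiv r) (of_real (2 * t - 1))) \<le> 16 * real n ^ 2 * M"
  proof (rule markov_symmetric_interval[OF _ n])
    show "degree r \<le> n"
      using degree_pcompose_le[of q "[:1/2, 1/2:]"] deg by (simp add: r_def)
    fix x :: real assume "\<bar>x\<bar> \<le> 1"
    then show "norm (poly r (of_real x)) \<le> M"
      using bd[of "(1 + x) / 2"] by (auto simp: r_def poly_pcompose add_divide_distrib abs_le_iff)
  qed (use t in auto)
  \<comment> \<open>The chain rule factor 1/2 of the affine map onto [0, 1] doubles the
    constant.\<close>
  also have "poly (pderiv r) (of_real (2 * t - 1)) = poly (pderiv q) (of_real t) / 2"
    by (simp add: r_def pderiv_pcompose poly_pcompose pderiv_pCons field_simps)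
  finally show ?thesis by (simp add: norm_divide)
qed

section \<open>From a steep increment to a large integral on the unit interval\<close>

lemma poly_lipschitz_unit_interval:
  fixes q :: "complex poly"
  assumes deg: "degree q \<le> n" and n: "n \<ge> 1"
    and bd: "\<And>t::real. t \<in> {0..1} \<Longrightarrow> norm (poly q (of_real t)) \<le> M"
    and st: "s \<in> {0..1}" "t \<in> {0..1}"
  shows "norm (poly q (of_real s) - poly q (of_real t)) \<le> 32 * real n ^ 2 * M * \<bar>s - t\<bar>"
proof -
  have "norm ((\<lambda>t. poly q (of_real t)) s - (\<lambda>t. poly q (of_real t)) t)
      \<le> 32 * real n ^ 2 * M * norm (s - t)"
  proof (rule differentiable_bound[where S = "{0..1}"])
    fix u :: real assume u: "u \<in> {0..1}"
    show "((\<lambda>t. poly q (of_real t)) has_derivative (\<lambda>h. h *\<^sub>R poly (pderiv q) (of_real u)))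
        (at u within {0..1})"
      using has_vector_derivative_real_field[OF poly_DERIV[of q "of_real u"]]
      unfolding has_vector_derivative_def .
    have "onorm (\<lambda>h::real. h *\<^sub>R poly (pderiv q) (of_real u)) \<le> norm (poly (pderiv q) (of_real u))"
      by (rule onorm_le) (simp add: mult.commute)
    then show "onorm (\<lambda>h::real. h *\<^sub>R poly (pderiv q) (of_real u)) \<le> 32 * real n ^ 2 * M"
      using markov_unit_interval[OF deg n bd u] by simp
  qed (use st in auto)
  then show ?thesis by simp
qed

text \<open>Let M be the maximum of |q| on [0, 1]. An increment of 1 over the gap |s - t| forces M
  >= 1/(32 n^2 |s - t|), and |q| stays above M/2 on an interval of length 1/(64 n^2) that ends or
  begins at a maximizer.\<close>

lemma integral_powr_ge_of_increment:
  fixes q :: "complex poly"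
  assumes deg: "degree q \<le> n" and n: "n \<ge> 1" and p: "0 < p"
    and st: "s \<in> {0..1}" "t \<in> {0..1}" "s \<noteq> t"
    and inc: "1 \<le> norm (poly q (of_real s) - poly q (of_real t))"
  shows "(1 / (64 * real n ^ 2 * \<bar>s - t\<bar>)) powr p / (64 * real n ^ 2)
       \<le> integral {0..1} (\<lambda>t. norm (poly q (of_real t)) powr p)"
proof -
  have "\<exists>u\<in>{0..1::real}. \<forall>t\<in>{0..1}. norm (poly q (of_real t)) \<le> norm (poly q (of_real u))"
    by (rule continuous_attains_sup) (auto intro!: continuous_intros)
  then obtain u :: real where u: "u \<in> {0..1}"
    and max: "\<And>t. t \<in> {0..1} \<Longrightarrow> norm (poly q (of_real t)) \<le> norm (poly q (of_real u))"
    by blast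
  define M where "M = norm (poly q (of_real u))"
  have lip: "norm (poly q (of_real s) - poly q (of_real t)) \<le> 32 * real n ^ 2 * M * \<bar>s - t\<bar>"
    if "s \<in> {0..1}" "t \<in> {0..1}" for s t :: real
    using poly_lipschitz_unit_interval[OF deg n max that] by (simp add: M_def)
  have "1 \<le> 32 * real n ^ 2 * M * \<bar>s - t\<bar>"
    using lip[OF st(1,2)] inc by simp
  then have M: "1 / (64 * real n ^ 2 * \<bar>s - t\<bar>) \<le> M / 2"
    using n st(3) by (simp add: field_simps)
  \<comment> \<open>Over a length \<open>d\<close> the Lipschitz bound 32 n^2 M allows a loss of
    exactly M/2.\<close>
  define d where "d = 1 / (64 * real n ^ 2)"
  have "1 \<le> real n ^ 2" using n by simp
  then have "2 \<le> 64 * real n ^ 2" by linarith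
  then have d: "0 < d" "d \<le> 1 / 2"
    using le_imp_inverse_le[of 2 "64 * real n ^ 2"] n by (simp_all add: d_def inverse_eq_divide)
  \<comment> \<open>The interval of length \<open>d\<close> extends from \<open>u\<close> towards
    the farther end of [0, 1], so that \<open>d\<close> <= 1/2 keeps it inside.\<close>
  define a where "a = (if u \<le> 1 / 2 then u else u - d)"
  have a: "0 \<le> a" "a + d \<le> 1" "a \<le> u" "u \<le> a + d"
    using d u by (auto simp: a_def)
  have cont: "continuous_on {0..1} (\<lambda>t::real. norm (poly q (of_real t)) powr p)"
    using p by (intro continuous_on_powr' continuous_intros) auto
  have "(1 / (64 * real n ^ 2 * \<bar>s - t\<bar>)) powr p * d \<le> (M / 2) powr p * d"
    using M d p by (intro mult_right_mono powr_mono2) auto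
  also have "\<dots> = integral {a..a + d} (\<lambda>t. (M / 2) powr p)"
    using d by simp
  also have "\<dots> \<le> integral {a..a + d} (\<lambda>t. norm (poly q (of_real t)) powr p)"
  proof (rule integral_le)
    fix t assume t: "t \<in> {a..a + d}"
    then have t01: "t \<in> {0..1}" and tu: "\<bar>u - t\<bar> \<le> d" using a by auto
    have "M - norm (poly q (of_real t)) \<le> 32 * real n ^ 2 * M * \<bar>u - t\<bar>"
      using lip[OF u t01] norm_triangle_ineq2[of "poly q (of_real u)" "poly q (of_real t)"]
      by (simp add: M_def)
    also have "\<dots> \<le> 32 * real n ^ 2 * M * d"
      using tu by (intro mult_left_mono) (auto simp: M_def)
    also have "\<dots> = M / 2" using n by (simp add: d_def)
    finally show "(M / 2) powr p \<le> norm (poly q (of_real t)) powr p"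
      using p by (intro powr_mono2) (auto simp: M_def)
  next
    show "(\<lambda>t. norm (poly q (of_real t)) powr p) integrable_on {a..a + d}"
      using a by (intro integrable_continuous_real continuous_on_subset[OF cont]) auto
  qed auto
  also have "\<dots> \<le> integral {0..1} (\<lambda>t. norm (poly q (of_real t)) powr p)"
    using a by (intro integral_subset_le integrable_continuous_real cont
        continuous_on_subset[OF cont]) auto
  finally show ?thesis by (simp add: d_def)
qed

section \<open>The maximum over polynomials\<close>

text \<open>This endpoint of the upper segment is \<open>psi0 (cis (2 * pi / 3))\<close>; the lower
  segment ends at its conjugate.\<close>

definition tip :: complex where
  "tip = (-1 + \<i>) * of_real (27 powr (1/4) / sqrt 2)"

lemma norm_tip: "norm tip = 27 powr (1/4)"
proof -
  have "norm (-1 + \<i>) = sqrt 2" by (simp add: cmod_def)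
  then show ?thesis by (simp only: tip_def norm_mult norm_of_real) simp
qed

lemma tip_nonzero: "tip \<noteq> 0"
  using norm_tip by (metis norm_zero powr_eq_0_iff zero_neq_numeral)

section \<open>Arc length integrals over the two segments\<close>

lemma has_integral_half_path:
  fixes f :: "real \<Rightarrow> real"
  assumes "continuous_on {0..1} f"
  shows "((\<lambda>t. f (2 * t) * 2) has_integral integral {0..1} f) {0..1/2}"
    and "((\<lambda>t. f (2 * t - 1) * 2) has_integral integral {0..1} f) {1/2..1}"
proof -
  have "(f has_integral integral {0..1} f) (cbox 0 1)"
    using integrable_continuous_real[OF assms] by (simp add: has_integral_integral)
  note I = this
  have "(\<lambda>x::real. x / 2 + 1 / 2) ` {0..1} = {1/2..1}" "(\<lambda>x::real. x / 2) ` {0..1} = {0..1/2}"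
    using image_affinity_atLeastAtMost_div[of 2 "1/2" 0 "1::real"]
      image_affinity_atLeastAtMost_div[of 2 0 0 "1::real"] by simp_all
  with has_integral_affinity[OF I, of 2 0] has_integral_affinity[OF I, of 2 "-1"]
  have "((\<lambda>x. f (2 * x)) has_integral integral {0..1} f / 2) {0..1/2}"
    and "((\<lambda>x. f (2 * x - 1)) has_integral integral {0..1} f / 2) {1/2..1}"
    by simp_all
  from this[THEN has_integral_mult_left, of 2]
  show "((\<lambda>t. f (2 * t) * 2) has_integral integral {0..1} f) {0..1/2}"
    and "((\<lambda>t. f (2 * t - 1) * 2) has_integral integral {0..1} f) {1/2..1}"
    by simp_all
qed

text \<open>The path runs from \<open>tip\<close> to 0 and then to \<open>cnj tip\<close>, each half
  at constant speed 2 |tip|; rescaling each half to [0, 1] absorbs the 2. The corner at parameter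
  1/2 is a single point and does not affect the integral.\<close>

lemma arclength_integral_gamma0:
  assumes "continuous_on UNIV F"
  shows "arclength_integral gamma0_path F =
    27 powr (1/4) * (integral {0..1} (\<lambda>t. F (tip * of_real (1 - t)))
      + integral {0..1} (\<lambda>t. F (cnj tip * of_real t)))"
proof -
  let ?R = "27 powr (1/4) :: real"
  have cnj_tip: "(-1 - \<i>) * of_real (27 powr (1/4) / sqrt 2) = cnj tip"
    by (simp add: tip_def)
  have path: "gamma0_path = linepath tip 0 +++ linepath 0 (cnj tip)"
    unfolding gamma0_path_def cnj_tip by (simp add: tip_def)
  define g1 g2 where "g1 = (\<lambda>t. F (tip * of_real (1 - t)))" and "g2 = (\<lambda>t. F (cnj tip * of_real t))"
  have cont: "continuous_on {0..1} g1" "continuous_on {0..1} g2"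
    unfolding g1_def g2_def
    by (intro continuous_on_compose2[OF assms] continuous_intros; simp)+
  let ?h = "\<lambda>t. F (gamma0_path t) * norm (vector_derivative gamma0_path (at t within {0..1}))"
  have h1: "?h t = g1 (2 * t) * 2 * ?R" if t: "t \<in> {0..1/2} - {1/2}" for t
  proof -
    have eq: "gamma0_path x = tip * of_real (1 - 2 * x)" if "x < 1 / 2" for x
      using that by (simp add: path joinpaths_def linepath_def scaleR_conv_of_real)
    have "((\<lambda>x. tip * of_real (1 - 2 * x)) has_vector_derivative (- 2 * tip)) (at t)"
      by (auto intro!: derivative_eq_intros simp: has_vector_derivative_def scaleR_conv_of_real)
    then have "(gamma0_path has_vector_derivative (- 2 * tip)) (at t)"
      by (rule has_vector_derivative_transform_within_open[where S = "{..<1/2}"]) (use t eq in auto)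
    then have "vector_derivative gamma0_path (at t within {0..1}) = - 2 * tip"
      by (rule vector_derivative_at_within_ivl) (use t in auto)
    then show ?thesis using t by (simp add: eq g1_def norm_mult norm_tip)
  qed
  have h2: "?h t = g2 (2 * t - 1) * 2 * ?R" if t: "t \<in> {1/2..1} - {1/2}" for t
  proof -
    have eq: "gamma0_path x = cnj tip * of_real (2 * x - 1)" if "x > 1 / 2" for x
      using that by (simp add: path joinpaths_def linepath_def scaleR_conv_of_real)
    have "((\<lambda>x. cnj tip * of_real (2 * x - 1)) has_vector_derivative (2 * cnj tip)) (at t)"
      by (auto intro!: derivative_eq_intros simp: has_vector_derivative_def scaleR_conv_of_real)
    then have "(gamma0_path has_vector_derivative (2 * cnj tip)) (at t)"
      by (rule has_vector_derivative_transform_within_open[where S = "{1/2<..}"]) (use t eq in auto)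
    then have "vector_derivative gamma0_path (at t within {0..1}) = 2 * cnj tip"
      by (rule vector_derivative_at_within_ivl) (use t in auto)
    then show ?thesis using t by (simp add: eq g2_def norm_mult norm_tip)
  qed
  have "(?h has_integral integral {0..1} g1 * ?R) {0..1/2}"
    by (rule has_integral_spike_finite[where S = "{1/2}", OF _ h1 has_integral_mult_left])
      (auto intro: has_integral_half_path cont)
  moreover have "(?h has_integral integral {0..1} g2 * ?R) {1/2..1}"
    by (rule has_integral_spike_finite[where S = "{1/2}", OF _ h2 has_integral_mult_left])
      (auto intro: has_integral_half_path cont)
  ultimately have "(?h has_integral integral {0..1} g1 * ?R + integral {0..1} g2 * ?R) {0..1}"
    by (rule has_integral_combine[rotated 2]) auto
  then show ?thesis
    unfolding arclength_integral_def g1_def [symmetric] g2_def [symmetric]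
    by (simp add: integral_unique algebra_simps)
qed

lemma continuous_on_norm_poly_powr:
  fixes P :: "complex poly"
  assumes "0 < p" "continuous_on S f"
  shows "continuous_on S (\<lambda>x. norm (poly P (f x)) powr p)"
proof (rule continuous_on_powr')
  show "continuous_on S (\<lambda>x. norm (poly P (f x)))"
    by (intro continuous_on_norm continuous_on_poly assms)
qed (use assms in auto)

text \<open>If the integral over the upper segment vanished, P would have infinitely many
  zeros.\<close>

lemma arclength_integral_poly_powr_pos:
  fixes P :: "complex poly"
  assumes "0 < p" "P \<noteq> 0"
  shows "0 < arclength_integral gamma0_path (\<lambda>z. norm (poly P z) powr p)"
proof -
  let ?f = "\<lambda>t::real. norm (poly P (tip * of_real (1 - t))) powr p"
  let ?g = "\<lambda>t::real. norm (poly P (cnj tip * of_real t)) powr p"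
  have cont: "continuous_on {0..1} ?f" "continuous_on {0..1} ?g"
    using assms(1) by (intro continuous_on_norm_poly_powr continuous_intros; simp)+
  have "integral {0..1} ?f \<noteq> 0"
  proof
    assume "integral {0..1} ?f = 0"
    then have "\<forall>t\<in>{0..1}. ?f t = 0"
      using integral_eq_0_iff[OF cont(1)] by simp
    then have "(\<lambda>t::real. tip * of_real (1 - t)) ` {0..1} \<subseteq> {z. poly P z = 0}"
      by auto
    then have "finite ((\<lambda>t::real. tip * of_real (1 - t)) ` {0..1})"
      using poly_roots_finite[OF assms(2)] by (rule finite_subset)
    moreover have "inj_on (\<lambda>t::real. tip * of_real (1 - t)) {0..1}"
      using tip_nonzero by (auto intro!: inj_onI)
    ultimately have "finite {0..1::real}" by (rule finite_imageD)
    then show False using infinite_Icc[of 0 "1::real"] by simp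
  qed
  moreover have "0 \<le> integral {0..1} ?f" "0 \<le> integral {0..1} ?g"
    by (intro integral_nonneg integrable_continuous_real cont; simp)+
  ultimately show ?thesis
    using assms by (subst arclength_integral_gamma0)
      (auto intro!: continuous_on_norm_poly_powr continuous_intros)
qed

text \<open>The unit sphere of the maximum norm is a finite union, over the index whose coordinate
  has modulus 1, of products of compact sets: circles, discs and {0}. Tychonoff's theorem applies to
  each product.\<close>

lemma compact_unit_coefficients:
  fixes n :: nat
  shows "compact {c :: nat \<Rightarrow> complex. (\<forall>j. norm (c j) \<le> 1) \<and> (\<forall>j>n. c j = 0) \<and> (\<exists>i\<le>n. norm (c i) = 1)}"
    (is "compact ?K")
proof -
  define B where "B = (\<lambda>i j. if j = i then sphere 0 1 else if j \<le> n then cball 0 1 else {0 :: complex})"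
  have "compact (PiE UNIV (B i))" for i
    unfolding compactin_euclidean_iff [symmetric] euclidean_product_topology [symmetric] compactin_PiE
    unfolding compactin_euclidean_iff B_def by auto
  then have "compact (\<Union>i\<le>n. PiE UNIV (B i))"
    by (intro compact_UN) auto
  also have "(\<Union>i\<le>n. PiE UNIV (B i)) = ?K"
  proof (intro equalityI subsetI)
    fix c assume "c \<in> (\<Union>i\<le>n. PiE UNIV (B i))"
    then obtain i where i: "i \<le> n" "\<And>j. c j \<in> B i j" by (auto simp: PiE_iff)
    have "norm (c j) \<le> 1" "j > n \<Longrightarrow> c j = 0" for j
      using i(2)[of j] i(1) by (auto simp: B_def split: if_splits)
    moreover have "norm (c i) = 1" using i(2)[of i] by (simp add: B_def)
    ultimately show "c \<in> ?K" using i(1) by blast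
  next
    fix c assume "c \<in> ?K"
    then obtain i where c: "\<And>j. norm (c j) \<le> 1" "\<And>j. j > n \<Longrightarrow> c j = 0" "i \<le> n" "norm (c i) = 1"
      by blast
    then have "c \<in> PiE UNIV (B i)" by (auto simp: PiE_iff B_def)
    then show "c \<in> (\<Union>i\<le>n. PiE UNIV (B i))" using c(3) by blast
  qed
  finally show ?thesis .
qed

section \<open>Polynomials as coefficient vectors, up to scaling\<close>

definition poly_of_coeffs :: "nat \<Rightarrow> (nat \<Rightarrow> complex) \<Rightarrow> complex poly" where
  "poly_of_coeffs n c = (\<Sum>i\<le>n. monom (c i) i)"

lemma poly_poly_of_coeffs: "poly (poly_of_coeffs n c) z = (\<Sum>i\<le>n. c i * z ^ i)"
  by (simp add: poly_of_coeffs_def poly_sum poly_monom)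

lemma coeff_poly_of_coeffs: "coeff (poly_of_coeffs n c) i = (if i \<le> n then c i else 0)"
  by (simp add: poly_of_coeffs_def coeff_sum)

lemma degree_poly_of_coeffs: "degree (poly_of_coeffs n c) \<le> n"
  by (rule degree_le) (simp add: coeff_poly_of_coeffs)

text \<open>The scale is the largest modulus of a coefficient, which is positive because the leading
  coefficient is nonzero.\<close>

lemma normalize_coefficients:
  fixes P :: "complex poly"
  assumes "P \<noteq> 0" "degree P \<le> n"
  obtains a c where "a > 0" "P = smult (of_real a) (poly_of_coeffs n c)"
    "\<forall>j. norm (c j) \<le> 1" "\<forall>j>n. c j = 0" "\<exists>i\<le>n. norm (c i) = 1"
proof -
  define a where "a = Max ((\<lambda>i. norm (coeff P i)) ` {..n})"
  have le: "norm (coeff P i) \<le> a" if "i \<le> n" for i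
    using that by (auto simp: a_def intro!: Max_ge)
  have "a \<in> (\<lambda>i. norm (coeff P i)) ` {..n}"
    unfolding a_def by (rule Max_in) auto
  then obtain i where i: "i \<le> n" "a = norm (coeff P i)" by auto
  have "0 < norm (coeff P (degree P))" using assms(1) by simp
  then have a: "a > 0" using le[OF assms(2)] by linarith
  define c where "c = (\<lambda>i. coeff P i / of_real a)"
  show ?thesis
  proof (rule that[of a c])
    show "P = smult (of_real a) (poly_of_coeffs n c)"
      using a assms(2) by (auto simp: poly_eq_iff coeff_poly_of_coeffs c_def coeff_eq_0)
    show "\<forall>j>n. c j = 0" using assms(2) by (simp add: c_def coeff_eq_0)
    then show "\<forall>j. norm (c j) \<le> 1"
      using le a by (metis c_def divide_le_eq_1_pos norm_divide norm_of_real abs_of_pos norm_zero zero_le_one not_le)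
    show "\<exists>i\<le>n. norm (c i) = 1"
      using i a by (auto simp: c_def norm_divide intro!: exI[of _ i])
  qed (fact a)
qed

lemma continuous_on_poly_of_coeffs_powr:
  fixes g :: "'a::topological_space \<Rightarrow> nat \<Rightarrow> complex"
  assumes "0 < p" "\<And>i. continuous_on S (\<lambda>x. g x i)" "continuous_on S h"
  shows "continuous_on S (\<lambda>x. norm (poly (poly_of_coeffs n (g x)) (h x)) powr p)"
  unfolding poly_poly_of_coeffs
  using assms by (intro continuous_on_powr' continuous_intros) auto

text \<open>The integrand is jointly continuous in the coefficients and the parameter, also at zeros
  of the polynomial since p > 0, and the parameter interval is compact.\<close>

lemma continuous_on_arclength_integral_coeffs:
  assumes "0 < p"
  shows "continuous_on UNIV
    (\<lambda>c. arclength_integral gamma0_path (\<lambda>z. norm (poly (poly_of_coeffs n c) z) powr p))"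
proof -
  have coord: "continuous_on S (\<lambda>x. fst x i)" for S :: "((nat \<Rightarrow> complex) \<times> real) set" and i
    by (rule continuous_on_compose2[OF continuous_on_product_coordinates[of i] continuous_on_fst])
      (auto intro: continuous_intros)
  have *: "continuous_on UNIV
      (\<lambda>c. integral {0..1::real} (\<lambda>t. norm (poly (poly_of_coeffs n c) (h t)) powr p))"
    if "continuous_on UNIV h" for h
    unfolding interval_cbox
    by (rule integral_continuous_on_param)
      (auto simp: case_prod_beta intro!: continuous_on_poly_of_coeffs_powr[OF assms] coord
        continuous_on_compose2[OF that] continuous_intros)
  have eq: "(\<lambda>c. arclength_integral gamma0_path (\<lambda>z. norm (poly (poly_of_coeffs n c) z) powr p)) =
    (\<lambda>c. 27 powr (1/4) * (integral {0..1} (\<lambda>t. norm (poly (poly_of_coeffs n c) (tip * of_real (1 - t))) powr p)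
      + integral {0..1} (\<lambda>t. norm (poly (poly_of_coeffs n c) (cnj tip * of_real t)) powr p)))"
    using assms by (intro ext arclength_integral_gamma0 continuous_on_norm_poly_powr continuous_intros)
  show ?thesis
    unfolding eq by (intro continuous_intros *)
qed

lemma arclength_integral_smult:
  assumes "0 < p" "0 < a"
  shows "arclength_integral g (\<lambda>z. norm (poly (smult (of_real a) P) z) powr p)
       = a powr p * arclength_integral g (\<lambda>z. norm (poly P z) powr p)"
  using assms by (simp add: arclength_integral_def norm_mult powr_mult mult.assoc)

text \<open>Either the denominator vanishes at some admissible polynomial, whose quotient is then
  infinite and hence maximal, or the quotient is real, continuous on the compact set
  \<open>K\<close> and invariant under positive scaling.\<close>

lemma Sup_mz_quotients_attained:
  assumes p: "1 < p"
  shows "Sup (mz_quotients p n) \<in> mz_quotients p n"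
proof -
  define N where "N = (\<lambda>P. arclength_integral gamma0_path (\<lambda>z. norm (poly P z) powr p))"
  define D where "D = (\<lambda>P. \<Sum>k=0..n. norm (poly P (fejer n k)) powr p * infdist (fejer n k) (level_curve n))"
  have q: "mz_quotient p n P = ennreal (N P) / ennreal (D P)" for P
    by (simp add: mz_quotient_def N_def D_def)
  have N: "N P > 0" if "P \<noteq> 0" for P
    unfolding N_def using p that by (intro arclength_integral_poly_powr_pos) auto
  have D0: "D P \<ge> 0" for P
    unfolding D_def by (intro sum_nonneg mult_nonneg_nonneg) (auto simp: infdist_nonneg)
  have attained: "Sup (mz_quotients p n) \<in> mz_quotients p n"
    if "x \<in> mz_quotients p n" "\<And>y. y \<in> mz_quotients p n \<Longrightarrow> y \<le> x" for x
  proof -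
    have "Sup (mz_quotients p n) = x"
      by (rule antisym[OF Sup_least[OF that(2)] Sup_upper[OF that(1)]])
    then show ?thesis using that(1) by simp
  qed
  show ?thesis
  proof (cases "\<exists>P. P \<noteq> 0 \<and> degree P \<le> n \<and> D P = 0")
    case True
    then obtain P where P: "P \<noteq> 0" "degree P \<le> n" "D P = 0" by blast
    have "mz_quotient p n P = \<infinity>"
      unfolding q P(3) using N[OF P(1)] by simp
    moreover have "mz_quotient p n P \<in> mz_quotients p n"
      using P(1,2) unfolding mz_quotients_def by blast
    ultimately have "\<infinity> \<in> mz_quotients p n"
      by simp
    then show ?thesis by (rule attained) simp
  next
    case False
    then have D: "D P > 0" if "P \<noteq> 0" "degree P \<le> n" for P
    proof -
      have "D P \<noteq> 0" using False that by blast
      then show ?thesis using D0[of P] by linarith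
    qed
    define K where "K = {c :: nat \<Rightarrow> complex. (\<forall>j. norm (c j) \<le> 1) \<and> (\<forall>j>n. c j = 0) \<and> (\<exists>i\<le>n. norm (c i) = 1)}"
    have K_ne: "poly_of_coeffs n c \<noteq> 0" if "c \<in> K" for c
    proof -
      from that have "\<exists>i\<le>n. norm (c i) = 1" by (simp only: K_def mem_Collect_eq)
      then obtain i where i: "i \<le> n" "norm (c i) = 1" by (elim exE conjE)
      then have "coeff (poly_of_coeffs n c) i = c i" by (simp only: coeff_poly_of_coeffs if_True)
      moreover have "c i \<noteq> 0"
      proof
        assume "c i = 0"
        then show False using i(2) by simp
      qed
      ultimately show ?thesis by (metis coeff_0)
    qed
    have "(\<lambda>i. if i = 0 then 1 else 0) \<in> K"
      unfolding K_def by (intro CollectI conjI exI[of _ 0]) simp_all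
    then have ne: "K \<noteq> {}" by blast
    have compact: "compact K" unfolding K_def by (rule compact_unit_coefficients)
    have cont: "continuous_on K (\<lambda>c. N (poly_of_coeffs n c) / D (poly_of_coeffs n c))"
    proof (intro continuous_on_divide ballI)
      show "continuous_on K (\<lambda>c. N (poly_of_coeffs n c))"
        unfolding N_def
        by (rule continuous_on_subset[OF continuous_on_arclength_integral_coeffs]) (use p in auto)
      show "continuous_on K (\<lambda>c. D (poly_of_coeffs n c))"
        unfolding D_def
      proof (intro continuous_on_sum continuous_on_mult continuous_on_const)
        fix k
        show "continuous_on K (\<lambda>c. norm (poly (poly_of_coeffs n c) (fejer n k)) powr p)"
        proof (rule continuous_on_poly_of_coeffs_powr)
          show "continuous_on K (\<lambda>c. c i)" for i
            by (rule continuous_on_subset[OF continuous_on_product_coordinates]) simp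
        qed (use p in auto)
      qed
    next
      fix c assume "c \<in> K"
      then have "0 < D (poly_of_coeffs n c)"
        by (intro D K_ne degree_poly_of_coeffs)
      then show "D (poly_of_coeffs n c) \<noteq> 0" by linarith
    qed
    have "\<exists>c\<in>K. \<forall>c'\<in>K. N (poly_of_coeffs n c') / D (poly_of_coeffs n c')
        \<le> N (poly_of_coeffs n c) / D (poly_of_coeffs n c)"
      by (rule continuous_attains_sup[OF compact ne cont])
    then obtain c where c: "c \<in> K" and
      max: "\<And>c'. c' \<in> K \<Longrightarrow> N (poly_of_coeffs n c') / D (poly_of_coeffs n c') \<le> N (poly_of_coeffs n c) / D (poly_of_coeffs n c)"
      by blast
    have q': "mz_quotient p n P = ennreal (N P / D P)" if "P \<noteq> 0" "degree P \<le> n" for P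
      unfolding q using D[OF that] N[OF that(1)] by (intro divide_ennreal) auto
    show ?thesis
    proof (rule attained)
      show "mz_quotient p n (poly_of_coeffs n c) \<in> mz_quotients p n"
        using K_ne[OF c] degree_poly_of_coeffs unfolding mz_quotients_def by blast
      fix y assume "y \<in> mz_quotients p n"
      then obtain P where P: "P \<noteq> 0" "degree P \<le> n" "y = mz_quotient p n P"
        by (auto simp: mz_quotients_def)
      from P(1,2) obtain a c' where a: "a > 0" "P = smult (of_real a) (poly_of_coeffs n c')"
        and "\<forall>j. norm (c' j) \<le> 1" "\<forall>j>n. c' j = 0" "\<exists>i\<le>n. norm (c' i) = 1"
        by (rule normalize_coefficients)
      then have c': "c' \<in> K" by (simp add: K_def)
      \<comment> \<open>Numerator and denominator are both homogeneous of degree p, so normalizing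
        the coefficients keeps the quotient.\<close>
      have "N P = a powr p * N (poly_of_coeffs n c')"
        unfolding N_def a(2) using p a(1) by (intro arclength_integral_smult) auto
      moreover have "D P = a powr p * D (poly_of_coeffs n c')"
        unfolding D_def a(2) using a(1)
        by (simp add: norm_mult powr_mult sum_distrib_left mult.assoc)
      ultimately have "N P / D P = N (poly_of_coeffs n c') / D (poly_of_coeffs n c')"
        using a(1) by simp
      then show "y \<le> mz_quotient p n (poly_of_coeffs n c)"
        using max[OF c'] K_ne[OF c] degree_poly_of_coeffs
        by (simp add: P q' ennreal_leI)
    qed
  qed
qed

section \<open>Fejer points near the end of the arc\<close>

text \<open>For 0 < t < pi this is the squared modulus of \<open>psi0 (cis t)\<close>.\<close>

definition fejer_modulus_sq :: "real \<Rightarrow> real" where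
  "fejer_modulus_sq t = 4 * sin t * (1 - cos t)"

text \<open>For w = \<open>cis t\<close> the quotient (w - 1)/(w + 1) is i tan(t/2). Its principal
  root points along 1 + i, and the factor w - 1/w = 2 i sin t turns this into the direction -1 + i
  of the upper segment.\<close>

lemma psi0_cis:
  assumes "0 < t" "t < pi"
  shows "psi0 (cis t) = of_real (sqrt (fejer_modulus_sq t) / 27 powr (1/4)) * tip"
proof -
  have s: "sin t > 0" using assms by (rule sin_gt_zero)
  \<comment> \<open>This is tan(t/2), in a form that makes both \<open>us\<close> and
    \<open>uc\<close> immediate.\<close>
  define u where "u = (1 - cos t) / sin t"
  have u: "u \<ge> 0" using s by (simp add: u_def)
  have ne: "cis t + 1 \<noteq> 0" using s by (auto simp: complex_eq_iff)
  have us: "u * sin t = 1 - cos t" using s by (simp add: u_def)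
  have "u * (cos t + 1) = (1 - (cos t)\<^sup>2) / sin t"
    unfolding u_def times_divide_eq_left by (simp add: power2_eq_square algebra_simps)
  also have "\<dots> = sin t"
    unfolding cos_squared_eq using s by (simp add: power2_eq_square)
  finally have uc: "u * (cos t + 1) = sin t" .
  have "cis t - 1 = \<i> * of_real u * (cis t + 1)"
    using us uc by (simp add: complex_eq_iff)
  then have quot: "(cis t - 1) / (cis t + 1) = \<i> * of_real u"
    using ne by (simp add: field_simps)
  define b where "b = of_real (sqrt u / sqrt 2) * (1 + \<i>)"
  have "csqrt (\<i> * of_real u) = b"
  proof (rule csqrt_unique)
    show "b\<^sup>2 = \<i> * of_real u"
      using u by (simp add: b_def power_mult_distrib complex_eq_iff power2_eq_square)
    show "0 < Re b \<or> Re b = 0 \<and> 0 \<le> Im b"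
      using u by (auto simp: b_def)
  qed
  moreover have "cis t - 1 / cis t = 2 * \<i> * of_real (sin t)"
    by (simp add: complex_eq_iff divide_inverse)
  ultimately have "psi0 (cis t) = 2 * \<i> * of_real (sin t) * b"
    unfolding psi0_def quot by simp
  also have "\<dots> = of_real (2 * sin t * sqrt u / sqrt 2) * (-1 + \<i>)"
    by (simp add: b_def complex_eq_iff)
  also have "2 * sin t * sqrt u = sqrt ((2 * sin t)\<^sup>2 * u)"
    using s by (simp add: real_sqrt_mult)
  also have "(2 * sin t)\<^sup>2 * u = fejer_modulus_sq t"
    using us by (simp add: fejer_modulus_sq_def power2_eq_square mult.commute[of _ u] mult.assoc)
  finally show ?thesis by (simp add: tip_def)
qed

section \<open>Size and near symmetry of the modulus about 2 pi/3\<close>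

lemma powr_quarter_27_squared: "(27 powr (1/4))\<^sup>2 = 3 * sqrt (3::real)"
proof -
  have "(27 powr (1/4))\<^sup>2 = (27::real) powr (1/2)"
    by (simp add: power2_eq_square flip: powr_add)
  also have "\<dots> = sqrt (9 * 3)" by (simp add: powr_half_sqrt)
  finally show ?thesis by (simp only: real_sqrt_mult) simp
qed

lemma fejer_modulus_sq_le:
  shows "sqrt (fejer_modulus_sq t) \<le> 27 powr (1/4)"
proof (rule real_le_lsqrt[OF _ , unfolded powr_quarter_27_squared])
  \<comment> \<open>the maximum is attained at \<open>cos t = - 1/2\<close>, a double root of the defect\<close>
  have "27 - (fejer_modulus_sq t)\<^sup>2 = (2 * cos t + 1)\<^sup>2 * ((2 * cos t - 3)\<^sup>2 + 2)"
  proof -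
    have "(fejer_modulus_sq t)\<^sup>2 = 16 * (1 - (cos t)\<^sup>2) * (1 - cos t)\<^sup>2"
      by (simp add: fejer_modulus_sq_def power_mult_distrib sin_squared_eq)
    then show ?thesis by algebra
  qed
  then have "(fejer_modulus_sq t)\<^sup>2 \<le> (3 * sqrt 3)\<^sup>2"
    by (simp add: power_mult_distrib) (smt (verit) zero_le_power2 mult_nonneg_nonneg)
  then show "fejer_modulus_sq t \<le> (27 powr (1/4))\<^sup>2"
    unfolding powr_quarter_27_squared by (rule power2_le_imp_le) simp
qed simp

text \<open>Measured from pi/2 the function is 4 cos s (1 + sin s) with s in [0, pi/3]. The bound
  keeps square roots at least 1 when differences of squares are turned into differences of
  moduli.\<close>

lemma fejer_modulus_sq_ge:
  assumes "\<bar>h\<bar> \<le> pi / 6"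
  shows "2 \<le> fejer_modulus_sq (2 * pi / 3 + h)"
proof -
  define s where "s = pi / 6 + h"
  have s: "0 \<le> s" "s \<le> pi / 3" using assms by (auto simp: s_def)
  have eq: "2 * pi / 3 + h = pi / 2 + s" by (simp add: s_def)
  have "1 / 2 \<le> cos s"
    using cos_monotone_0_pi_le[OF s] by (simp add: cos_60)
  moreover have "0 \<le> sin s" using s by (intro sin_ge_zero) auto
  ultimately have "4 * (1/2) * 1 \<le> 4 * cos s * (1 + sin s)"
    by (intro mult_mono) auto
  then show ?thesis by (simp add: fejer_modulus_sq_def eq sin_add cos_add)
qed

text \<open>In 4 sin t - 2 sin 2t the odd part about 2 pi/3 is governed by cos(2 pi/3) = cos(4 pi/3)
  = -1/2. The terms linear in h cancel and the remainder is cubic.\<close>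

lemma fejer_modulus_sq_diff:
  "fejer_modulus_sq (2 * pi / 3 + h) - fejer_modulus_sq (2 * pi / 3 - h)
     = - 4 * sin h * (1 - cos h)"
proof -
  have *: "fejer_modulus_sq t = 4 * sin t - 2 * sin (2 * t)" for t
    unfolding sin_double by (simp add: fejer_modulus_sq_def algebra_simps)
  have "fejer_modulus_sq (2 * pi / 3 + h) - fejer_modulus_sq (2 * pi / 3 - h)
    = 8 * cos (2 * pi / 3) * sin h - 4 * cos (4 * pi / 3) * sin (2 * h)"
    unfolding * by (simp add: sin_add sin_diff ring_distribs)
  moreover have "cos (2 * pi / 3) = - 1 / 2" by (simp add: cos_120)
  moreover have "cos (4 * pi / 3) = - 1 / 2"
  proof -
    have "4 * pi / 3 = pi + pi / 3" by simp
    then show ?thesis by (simp only: cos_add) (simp add: cos_60)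
  qed
  ultimately show ?thesis by (simp only: sin_double) (simp add: algebra_simps)
qed

text \<open>The squares differ by at most 2 h^3 and the sum of the two roots is at least 2.
  Positivity keeps the two points distinct.\<close>

lemma fejer_modulus_diff:
  assumes "0 < h" "h \<le> pi / 6"
  shows "0 < sqrt (fejer_modulus_sq (2 * pi / 3 - h)) - sqrt (fejer_modulus_sq (2 * pi / 3 + h))"
    and "sqrt (fejer_modulus_sq (2 * pi / 3 - h)) - sqrt (fejer_modulus_sq (2 * pi / 3 + h)) \<le> h ^ 3"
proof -
  define a b where "a = fejer_modulus_sq (2 * pi / 3 - h)" and "b = fejer_modulus_sq (2 * pi / 3 + h)"
  have ab: "a \<ge> 2" "b \<ge> 2"
    using fejer_modulus_sq_ge[of h] fejer_modulus_sq_ge[of "-h"] assms by (auto simp: a_def b_def)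
  then have sq: "sqrt a \<ge> 1" "sqrt b \<ge> 1" by auto
  have diff: "a - b = 4 * sin h * (1 - cos h)"
    using fejer_modulus_sq_diff[of h] by (simp add: a_def b_def)
  have "sin h > 0" using assms by (intro sin_gt_zero) auto
  moreover have "cos h < 1" using cos_monotone_0_pi[of 0 h] assms by auto
  ultimately have "0 < a - b" unfolding diff by simp
  then have "a > b" by simp
  then show "0 < sqrt a - sqrt b" by simp
  have "sin h \<le> h" using assms by (intro sin_x_le_x) auto
  moreover have "1 - cos h \<le> h\<^sup>2 / 2"
    using cos_double_sin[of "h / 2"] power_mono[OF abs_sin_x_le_abs_x[of "h / 2"], of 2]
    by (simp add: power_divide)
  ultimately have "a - b \<le> 4 * h * (h\<^sup>2 / 2)"
    unfolding diff using assms \<open>sin h > 0\<close> by (intro mult_mono) auto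
  then have "(sqrt a - sqrt b) * (sqrt a + sqrt b) \<le> 2 * h ^ 3"
    using ab by (simp add: algebra_simps power2_eq_square power3_eq_cube)
  moreover have "(sqrt a - sqrt b) * 2 \<le> (sqrt a - sqrt b) * (sqrt a + sqrt b)"
    using sq \<open>a > b\<close> by (intro mult_left_mono) (simp_all del: real_sqrt_ge_1_iff)
  ultimately show "sqrt a - sqrt b \<le> h ^ 3" by simp
qed

text \<open>The square of \<open>psi0\<close> is the rational function (w - 1)^3 (w + 1)/w^2, which
  has no branch to follow. A double root of its difference gives the quadratic bound, after division
  by \<open>psi0 w + psi0 w0\<close>, which is bounded away from 0 near w0.\<close>

lemma psi0_quadratic_at_cube_root_of_unity:
  defines "w0 \<equiv> cis (2 * pi / 3)"
  obtains C \<delta> where "0 < C" "0 < \<delta>"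
    "\<And>w. 1 \<le> norm w \<Longrightarrow> dist w w0 < \<delta> \<Longrightarrow> dist (psi0 w) (psi0 w0) \<le> C * (dist w w0)\<^sup>2"
proof -
  have sq: "(psi0 w)\<^sup>2 = (w ^ 4 - 2 * w ^ 3 + 2 * w - 1) / w\<^sup>2" if "w \<noteq> 0" "w \<noteq> -1" for w
  proof -
    have "w + 1 \<noteq> 0" using that by (simp add: add_eq_0_iff2)
    then have "(w - 1 / w)\<^sup>2 * ((w - 1) / (w + 1)) = (w ^ 4 - 2 * w ^ 3 + 2 * w - 1) / w\<^sup>2"
      using that by (simp add: divide_simps) algebra
    then show ?thesis by (simp add: psi0_def power_mult_distrib)
  qed
  have w0: "w0 = Complex (-1/2) (sqrt 3 / 2)"
    by (simp add: w0_def complex_eq_iff cos_120 sin_120)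
  have w0_sq: "w0\<^sup>2 = - 1 - w0"
    by (simp add: w0 complex_eq_iff power2_eq_square)
  have w0_ne: "w0 \<noteq> 0" "w0 \<noteq> -1" "norm w0 = 1"
    by (simp_all add: w0_def) (simp add: w0 complex_eq_iff flip: w0_def)
  have psi0_w0: "(psi0 w0)\<^sup>2 = - 3 - 6 * w0"
  proof -
    have "w0 ^ 4 - 2 * w0 ^ 3 + 2 * w0 - 1 = (- 3 - 6 * w0) * w0\<^sup>2"
      using w0_sq by algebra
    then show ?thesis
      unfolding sq[OF w0_ne(1,2)] using w0_ne(1) by simp
  qed
  \<comment> \<open>\<open>w0\<close> is a critical point of the rational function \<open>psi0\<^sup>2\<close>, so the difference has a double root\<close>
  have factor: "(psi0 w)\<^sup>2 - (psi0 w0)\<^sup>2 = (w - w0)\<^sup>2 * ((w\<^sup>2 + (2 * w0 - 2) * w - w0) / w\<^sup>2)"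
    if "w \<noteq> 0" "w \<noteq> -1" for w
  proof -
    have "w ^ 4 - 2 * w ^ 3 + 2 * w - 1 - (- 3 - 6 * w0) * w\<^sup>2
        = (w - w0)\<^sup>2 * (w\<^sup>2 + (2 * w0 - 2) * w - w0)"
      using w0_sq by algebra
    then show ?thesis
      unfolding sq[OF that] psi0_w0 using that(1) by (simp add: field_simps)
  qed
  have "psi0 w0 \<noteq> 0"
  proof
    assume "psi0 w0 = 0"
    then have "- 3 - 6 * w0 = 0" using psi0_w0 by simp
    then show False by (simp add: w0 complex_eq_iff)
  qed
  define e where "e = norm (psi0 w0)"
  have e: "e > 0" using \<open>psi0 w0 \<noteq> 0\<close> by (simp add: e_def)
  obtain d where d: "d > 0" "\<And>w. 1 \<le> norm w \<Longrightarrow> dist w w0 < d \<Longrightarrow> dist (psi0 w) (psi0 w0) < e"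
    using continuous_on_psi0 w0_ne(3) e unfolding continuous_on_iff by (metis (no_types, lifting) mem_Collect_eq order_refl)
  show ?thesis
  \<comment> \<open>The radius \<open>d\<close> keeps the sum of the two values at least
    \<open>e\<close> in modulus; the radius 1 excludes w = -1, since |w0 + 1| = |w0^2| = 1.\<close>
  proof (rule that[of "10 / e" "min d 1"])
    fix w assume w: "1 \<le> norm w" "dist w w0 < min d 1"
    have "norm (w - w0) < 1" using w(2) by (simp add: dist_norm)
    moreover have "w0 - (-1) = - (w0\<^sup>2)" using w0_sq by simp
    then have "norm (w0 - (-1)) = 1" using w0_ne(3) by (simp add: norm_power)
    ultimately have "w \<noteq> -1" by (metis less_irrefl norm_minus_commute)
    moreover have "w \<noteq> 0" using w(1) by auto
    ultimately have fac: "(psi0 w)\<^sup>2 - (psi0 w0)\<^sup>2 = (w - w0)\<^sup>2 * ((w\<^sup>2 + (2 * w0 - 2) * w - w0) / w\<^sup>2)"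
      by (intro factor)
    have "e \<le> norm (psi0 w + psi0 w0)"
    proof -
      have "norm (2 * psi0 w0) \<le> norm (psi0 w + psi0 w0) + norm (psi0 w - psi0 w0)"
        using norm_triangle_ineq4[of "psi0 w + psi0 w0" "psi0 w - psi0 w0"] by (simp add: algebra_simps)
      then show ?thesis using d(2)[of w] w by (simp add: e_def dist_norm norm_mult)
    qed
    then have "e * dist (psi0 w) (psi0 w0) \<le> norm (psi0 w + psi0 w0) * dist (psi0 w) (psi0 w0)"
      by (intro mult_right_mono) auto
    also have "\<dots> = norm ((psi0 w)\<^sup>2 - (psi0 w0)\<^sup>2)"
      by (simp add: dist_norm power2_eq_square algebra_simps flip: norm_mult)
    also have "\<dots> = (dist w w0)\<^sup>2 * norm ((w\<^sup>2 + (2 * w0 - 2) * w - w0) / w\<^sup>2)"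
      unfolding fac by (simp only: norm_mult norm_power dist_norm times_divide_eq_right [symmetric])
    \<comment> \<open>For |w| >= 1 the quotient is at most 1 + 4 + 1 = 6; the value 10 is a rounded
      bound.\<close>
    also have "\<dots> \<le> (dist w w0)\<^sup>2 * 10"
    proof (intro mult_left_mono)
      have "norm (w\<^sup>2 + (2 * w0 - 2) * w - w0) \<le> norm w ^ 2 + norm (2 * w0 - 2) * norm w + norm w0"
        using norm_triangle_ineq4[of "w\<^sup>2 + (2 * w0 - 2) * w" w0]
          norm_triangle_ineq[of "w\<^sup>2" "(2 * w0 - 2) * w"]
        by (simp add: norm_mult norm_power)
      also have "\<dots> \<le> norm w ^ 2 + 4 * norm w ^ 2 + 1 * norm w ^ 2"
      proof (intro add_mono mult_mono)
        show "norm (2 * w0 - 2) \<le> 4"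
          using norm_triangle_ineq4[of "2 * w0" 2] w0_ne(3) by (simp add: norm_mult)
      qed (use w w0_ne(3) in \<open>auto simp: self_le_power\<close>)
      finally show "norm ((w\<^sup>2 + (2 * w0 - 2) * w - w0) / w\<^sup>2) \<le> 10"
        using w(1) zero_le_power2[of "norm w"]
        by (auto simp: norm_divide norm_power divide_le_eq intro: order_trans)
    qed auto
    finally show "dist (psi0 w) (psi0 w0) \<le> 10 / e * (dist w w0)\<^sup>2"
      using e by (simp add: field_simps)
  qed (use e d in auto)
qed

section \<open>Unboundedness of the quotients\<close>

lemma lagrange_basis_poly:
  fixes z :: complex
  assumes "finite S" "card S \<le> Suc n" "z \<in> S"
  obtains P where "degree P \<le> n" "poly P z = 1" "\<And>w. w \<in> S \<Longrightarrow> w \<noteq> z \<Longrightarrow> poly P w = 0"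
proof -
  define Q where "Q = (\<Prod>w\<in>S - {z}. [:- w, 1:])"
  have "degree Q = card (S - {z})"
    unfolding Q_def by (subst degree_prod_eq_sum_degree) auto
  then have "degree Q \<le> n" using assms by simp
  moreover have "poly Q z \<noteq> 0"
    using assms(1) by (simp add: Q_def poly_prod)
  moreover have "poly Q w = 0" if "w \<in> S" "w \<noteq> z" for w
    using that assms(1) by (auto simp: Q_def poly_prod)
  ultimately show ?thesis
    using that[of "smult (inverse (poly Q z)) Q"] degree_smult_le[of "inverse (poly Q z)" Q] by simp
qed

text \<open>A coincidence leaves at most n distinct nodes, so the monic polynomial with these zeros
  is admissible and has denominator 0. This covers the case that Lagrange interpolation cannot
  treat.\<close>

lemma Sup_mz_quotients_coincident:
  assumes p: "1 < p" and "\<not> inj_on (fejer n) {0..n}"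
  shows "Sup (mz_quotients p n) = \<infinity>"
proof -
  define S where "S = fejer n ` {0..n}"
  have "card S \<noteq> Suc n" "card S \<le> Suc n"
    using assms(2) card_image_le[of "{0..n}" "fejer n"] eq_card_imp_inj_on[of "{0..n}" "fejer n"]
    by (auto simp: S_def)
  then have "card S \<le> n" by simp
  define P where "P = (\<Prod>w\<in>S. [:- w, 1:])"
  have "degree P = card S"
    unfolding P_def by (subst degree_prod_eq_sum_degree) auto
  with \<open>card S \<le> n\<close> have P: "degree P \<le> n" "P \<noteq> 0"
    by (simp_all add: P_def S_def)
  have "poly P (fejer n k) = 0" if "k \<in> {0..n}" for k
    using that by (auto simp: P_def poly_prod S_def)
  then have D: "(\<Sum>k=0..n. norm (poly P (fejer n k)) powr p * infdist (fejer n k) (level_curve n)) = 0"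
    by simp
  have "mz_quotient p n P = \<infinity>"
    unfolding mz_quotient_def D using arclength_integral_poly_powr_pos[OF _ P(2), of p] p by simp
  moreover have "mz_quotient p n P \<in> mz_quotients p n"
    using P unfolding mz_quotients_def by blast
  ultimately show ?thesis
    by (metis Sup_upper infinity_ennreal_def top.extremum_uniqueI)
qed

text \<open>Here n is even and n + 1 = 3 (2j + 1), so index 2j + 1 has angle 2 pi/3 and its
  neighbours lie at distance h on either side, where the modulus is symmetric up to a cubic
  error.\<close>

lemma fejer_near_tip:
  assumes n: "n = 6 * j + 2" "j \<ge> 2"
  defines "h \<equiv> 2 * pi / (real n + 1)"
  obtains s t where "fejer n (2 * j) = of_real s * tip" "fejer n (2 * j + 2) = of_real t * tip"
    "s \<in> {0..1}" "t \<in> {0..1}" "0 < s - t" "s - t \<le> h ^ 3"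
proof -
  have n1: "real n + 1 = 3 * (2 * real j + 1)" using n by simp
  \<comment> \<open>From j >= 2 follows n + 1 >= 15, hence h <= 2 pi/15.\<close>
  have h: "0 < h" "h \<le> pi / 6"
    using n(2) unfolding h_def n1 by (simp_all add: field_simps)
  \<comment> \<open>Both indices are at most n div 2 = 3j + 1, so the first branch of
    \<open>theta\<close> applies.\<close>
  have th: "theta n (2 * j) = 2 * pi / 3 - h" "theta n (2 * j + 2) = 2 * pi / 3 + h"
    unfolding theta_def theta_upper_def h_def n1 using n by (simp_all add: field_simps)
  let ?R = "27 powr (1/4) :: real"
  have "(1::real) powr (1/4) \<le> ?R" by (intro powr_mono2) auto
  then have R: "1 \<le> ?R" by simp
  define s t where "s = sqrt (fejer_modulus_sq (2 * pi / 3 - h)) / ?R"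
    and "t = sqrt (fejer_modulus_sq (2 * pi / 3 + h)) / ?R"
  note diff = fejer_modulus_diff[OF h]
  have g: "2 \<le> fejer_modulus_sq (2 * pi / 3 - h)" "2 \<le> fejer_modulus_sq (2 * pi / 3 + h)"
    using fejer_modulus_sq_ge[of h] fejer_modulus_sq_ge[of "-h"] h by auto
  have st: "s - t = (sqrt (fejer_modulus_sq (2 * pi / 3 - h)) - sqrt (fejer_modulus_sq (2 * pi / 3 + h))) / ?R"
    by (simp add: s_def t_def diff_divide_distrib)
  show ?thesis
  proof (rule that[of s t])
    show "fejer n (2 * j) = of_real s * tip" "fejer n (2 * j + 2) = of_real t * tip"
      unfolding fejer_def th s_def t_def using h by (intro psi0_cis; linarith)+
    show "s \<in> {0..1}" "t \<in> {0..1}"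
      using fejer_modulus_sq_le g R by (auto simp: s_def t_def)
    show "0 < s - t" unfolding st using diff(1) R by simp
    have "s - t \<le> h ^ 3 / ?R" unfolding st using diff(2) R by (intro divide_right_mono) auto
    also have "\<dots> \<le> h ^ 3 / 1" using h R by (intro divide_left_mono) auto
    finally show "s - t \<le> h ^ 3" by simp
  qed
qed

text \<open>The Fejer preimage and a suitable point of the level circle both have distance O(1/n)
  from the critical point, so their images both lie within O(n^-2) of the tip.\<close>

lemma infdist_fejer_near_tip:
  obtains C J where "0 < C"
    "\<And>j n. j \<ge> J \<Longrightarrow> n = 6 * j + 2 \<Longrightarrow> infdist (fejer n (2 * j)) (level_curve n) \<le> C / real n ^ 2"
proof -
  define w0 where "w0 = cis (2 * pi / 3)"
  obtain C \<delta> where C: "0 < C" "0 < \<delta>"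
    and quad: "\<And>w. 1 \<le> norm w \<Longrightarrow> dist w w0 < \<delta> \<Longrightarrow> dist (psi0 w) (psi0 w0) \<le> C * (dist w w0)\<^sup>2"
    using psi0_quadratic_at_cube_root_of_unity unfolding w0_def by blast
  obtain J :: nat where J: "real J > 7 / \<delta>" using reals_Archimedean2 by blast
  show ?thesis
  \<comment> \<open>The constant is 50 = 7^2 + 1^2, from the distances 7/n of \<open>v\<close> and
    1/n of \<open>w\<close> to \<open>w0\<close>.\<close>
  proof (rule that[of "50 * C" "max J 2"])
    fix j n :: nat assume j: "max J 2 \<le> j" and n: "n = 6 * j + 2"
    have n1: "real n + 1 = 3 * (2 * real j + 1)" using n by simp
    have n0: "real n > 0" using n by simp
    define h where "h = 2 * pi / (real n + 1)"
    have h0: "0 < h" by (simp add: h_def)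
    have "h \<le> 7 / (real n + 1)"
      unfolding h_def using pi_approx by (intro divide_right_mono) auto
    also have "\<dots> \<le> 7 / real n" using n0 by (intro divide_left_mono) auto
    finally have h: "h \<le> 7 / real n" .
    have "real J \<le> real n" using j n by simp
    then have "7 / \<delta> < real n" using J by linarith
    then have small: "7 / real n < \<delta>" using n0 C by (simp add: field_simps)
    have th: "theta n (2 * j) = 2 * pi / 3 - h"
      unfolding theta_def theta_upper_def h_def n1 using n by (simp add: field_simps)
    \<comment> \<open>The witness \<open>w\<close> is the radial projection of \<open>w0\<close>
      onto the level circle, and \<open>v\<close> is the preimage of the Fejer point.\<close>
    define w v where "w = of_real (1 + 1 / (real n + 1)) * w0" and "v = cis (2 * pi / 3 - h)"
    have nw0: "norm w0 = 1" by (simp add: w0_def)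
    have norm_w: "norm w = 1 + 1 / (real n + 1)"
      unfolding w_def norm_mult nw0 norm_of_real by simp
    have "w - w0 = of_real (1 / (real n + 1)) * w0"
      by (simp add: w_def algebra_simps)
    then have "dist w w0 = 1 / (real n + 1)"
      unfolding dist_norm by (simp only: norm_mult nw0 norm_of_real) simp
    also have "\<dots> \<le> 1 / real n" using n0 by (intro divide_left_mono) auto
    finally have dw: "dist w w0 \<le> 1 / real n" .
    have "norm (cis (- h) - 1) \<le> h"
    proof -
      have "(norm (cis (- h) - 1))\<^sup>2 = (2 * sin (h / 2))\<^sup>2"
        using cos_double_sin[of "h / 2"] sin_cos_squared_add[of h]
        unfolding cmod_power2 by (simp add: power2_eq_square algebra_simps)
      then have "norm (cis (- h) - 1) = \<bar>2 * sin (h / 2)\<bar>"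
        by (metis abs_norm_cancel real_sqrt_abs)
      also have "\<dots> \<le> h" using abs_sin_x_le_abs_x[of "h / 2"] h0 by simp
      finally show ?thesis .
    qed
    moreover have "v - w0 = (cis (- h) - 1) * w0"
      by (simp add: v_def w0_def left_diff_distrib cis_mult)
    ultimately have "dist v w0 \<le> h"
      by (simp add: dist_norm norm_mult nw0)
    then have dv: "dist v w0 \<le> 7 / real n" using h by linarith
    have "1 / real n \<le> 7 / real n" using n0 by (intro divide_right_mono) auto
    then have "dist (psi0 w) (psi0 w0) \<le> C * (dist w w0)\<^sup>2" "dist (psi0 v) (psi0 w0) \<le> C * (dist v w0)\<^sup>2"
      using dw dv small norm_w by (auto intro!: quad simp: v_def)
    moreover have "C * (dist w w0)\<^sup>2 \<le> C * (1 / real n)\<^sup>2" "C * (dist v w0)\<^sup>2 \<le> C * (7 / real n)\<^sup>2"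
      using dw dv C by (auto intro!: mult_left_mono power_mono)
    moreover have "dist (psi0 v) (psi0 w) \<le> dist (psi0 v) (psi0 w0) + dist (psi0 w) (psi0 w0)"
      by (rule dist_triangle2)
    ultimately have "dist (psi0 v) (psi0 w) \<le> C * (7 / real n)\<^sup>2 + C * (1 / real n)\<^sup>2"
      by linarith
    also have "\<dots> = 50 * C / real n ^ 2"
      by (simp add: power_divide add_divide_distrib [symmetric])
    finally have "dist (psi0 v) (psi0 w) \<le> 50 * C / real n ^ 2" .
    moreover have "psi0 w \<in> level_curve n"
      using norm_w unfolding level_curve_def by blast
    moreover have "fejer n (2 * j) = psi0 v"
      by (simp add: fejer_def th v_def)
    ultimately show "infdist (fejer n (2 * j)) (level_curve n) \<le> 50 * C / real n ^ 2"
      by (simp add: infdist_le2)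
  qed (use C in auto)
qed

text \<open>The constant is \<open>21952 = 64 * 7^3\<close>, where 7 bounds \<open>2\<pi>\<close>.\<close>

lemma mz_quotient_lagrange_ge:
  assumes p: "1 < p" and j: "2 \<le> j" and n: "n = 6 * j + 2" and C: "0 < C"
    and dist: "infdist (fejer n (2 * j)) (level_curve n) \<le> C / real n ^ 2"
    and inj: "inj_on (fejer n) {0..n}"
  shows "ennreal ((real n / 21952) powr p / (64 * C)) \<le> Sup (mz_quotients p n)"
proof -
  define h where "h = 2 * pi / (real n + 1)"
  have n0: "real n > 0" "n \<ge> 1" using n by auto
  obtain s t where st: "fejer n (2 * j) = of_real s * tip" "fejer n (2 * j + 2) = of_real t * tip"
    "s \<in> {0..1}" "t \<in> {0..1}" "0 < s - t" "s - t \<le> h ^ 3"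
    using fejer_near_tip[OF n j] unfolding h_def by blast
  have "h \<le> 7 / (real n + 1)"
    unfolding h_def using pi_approx by (intro divide_right_mono) auto
  also have "\<dots> \<le> 7 / real n" using n0 by (intro divide_left_mono) auto
  finally have "h ^ 3 \<le> (7 / real n) ^ 3"
    by (intro power_mono) (auto simp: h_def)
  then have gap: "s - t \<le> 343 / real n ^ 3"
    using st(6) by (simp add: power_divide)
  have k: "2 * j \<in> {0..n}" "2 * j + 2 \<in> {0..n}" using n by auto
  obtain P where P: "degree P \<le> n" "poly P (fejer n (2 * j)) = 1"
    "\<And>w. w \<in> fejer n ` {0..n} \<Longrightarrow> w \<noteq> fejer n (2 * j) \<Longrightarrow> poly P w = 0"
    using lagrange_basis_poly[of "fejer n ` {0..n}" n "fejer n (2 * j)"] k inj by (auto simp: card_image)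
  have zero: "poly P (fejer n i) = 0" if "i \<in> {0..n}" "i \<noteq> 2 * j" for i
    using that P(3)[of "fejer n i"] inj_onD[OF inj _ that(1) k(1)] by blast
  define N where "N = arclength_integral gamma0_path (\<lambda>z. norm (poly P z) powr p)"
  define D where "D = (\<Sum>k=0..n. norm (poly P (fejer n k)) powr p * infdist (fejer n k) (level_curve n))"
  \<comment> \<open>Only the node with index 2j survives, with weight 1.\<close>
  have "D = (\<Sum>k\<in>{0..n}. if k = 2 * j then infdist (fejer n (2 * j)) (level_curve n) else 0)"
    unfolding D_def using zero P(2) by (intro sum.cong) auto
  then have D: "D \<le> C / real n ^ 2" "0 \<le> D"
    using dist k by (auto simp: infdist_nonneg)
  \<comment> \<open>The unit interval runs from \<open>tip\<close> to 0, as in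
    \<open>arclength_integral_gamma0\<close>, so the node \<open>of_real s * tip\<close> sits at 1 -
    s.\<close>
  define q where "q = pcompose P [:tip, - tip:]"
  have q: "poly q (of_real x) = poly P (tip * of_real (1 - x))" for x
    by (simp add: q_def poly_pcompose algebra_simps)
  have "degree q \<le> n"
    using P(1) degree_pcompose_le[of P "[:tip, - tip:]"] by (simp add: q_def split: if_splits)
  moreover have "poly q (of_real (1 - s)) = 1" "poly q (of_real (1 - t)) = 0"
    using P(2) zero[OF k(2)] unfolding q st(1,2) by (simp_all add: mult.commute)
  ultimately have "(1 / (64 * real n ^ 2 * \<bar>(1 - s) - (1 - t)\<bar>)) powr p / (64 * real n ^ 2)
      \<le> integral {0..1} (\<lambda>x. norm (poly q (of_real x)) powr p)"
    using n0 p st by (intro integral_powr_ge_of_increment) auto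
  moreover have "\<bar>(1 - s) - (1 - t)\<bar> = s - t" using st by simp
  moreover have "(real n / 21952) powr p / (64 * real n ^ 2) \<le> (1 / (64 * real n ^ 2 * (s - t))) powr p / (64 * real n ^ 2)"
  proof (intro divide_right_mono powr_mono2)
    have "64 * real n ^ 2 * (s - t) \<le> 64 * real n ^ 2 * (343 / real n ^ 3)"
      using gap by (intro mult_left_mono) auto
    also have "\<dots> = 21952 / real n"
      using n0 by (simp add: power2_eq_square power3_eq_cube)
    finally have "64 * real n ^ 2 * (s - t) \<le> 21952 / real n" .
    then have "1 / (21952 / real n) \<le> 1 / (64 * real n ^ 2 * (s - t))"
      using st(5) n0 by (intro divide_left_mono mult_pos_pos) auto
    then show "real n / 21952 \<le> 1 / (64 * real n ^ 2 * (s - t))" by simp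
  qed (use p in auto)
  ultimately have I: "(real n / 21952) powr p / (64 * real n ^ 2)
      \<le> integral {0..1} (\<lambda>x. norm (poly P (tip * of_real (1 - x))) powr p)"
    unfolding q by simp
  \<comment> \<open>The upper segment alone suffices: the length factor is at least 1 and the lower
    segment contributes a nonnegative amount.\<close>
  have "1 * integral {0..1} (\<lambda>x. norm (poly P (tip * of_real (1 - x))) powr p)
      \<le> 27 powr (1/4) * (integral {0..1} (\<lambda>x. norm (poly P (tip * of_real (1 - x))) powr p)
        + integral {0..1} (\<lambda>x. norm (poly P (cnj tip * of_real x)) powr p))"
  proof (rule mult_mono)
    have "(1::real) powr (1/4) \<le> 27 powr (1/4)" by (intro powr_mono2) auto
    then show "(1::real) \<le> 27 powr (1/4)" by simp
    have "0 \<le> integral {0..1} (\<lambda>x. norm (poly P (cnj tip * of_real x)) powr p)"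
      using p by (intro integral_nonneg integrable_continuous_real continuous_on_norm_poly_powr
          continuous_intros) auto
    then show "integral {0..1} (\<lambda>x. norm (poly P (tip * of_real (1 - x))) powr p)
      \<le> integral {0..1} (\<lambda>x. norm (poly P (tip * of_real (1 - x))) powr p)
        + integral {0..1} (\<lambda>x. norm (poly P (cnj tip * of_real x)) powr p)" by simp
    show "0 \<le> integral {0..1} (\<lambda>x. norm (poly P (tip * of_real (1 - x))) powr p)"
      by (rule order_trans[OF _ I]) simp
  qed simp
  also have "\<dots> = N"
    unfolding N_def using p
    by (intro arclength_integral_gamma0[symmetric] continuous_on_norm_poly_powr continuous_intros) auto
  finally have N: "(real n / 21952) powr p / (64 * real n ^ 2) \<le> N"
    using I by simp
  have "0 < (real n / 21952) powr p / (64 * real n ^ 2)"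
    using n0 by simp
  with N have "0 < N" by linarith
  have "ennreal ((real n / 21952) powr p / (64 * C)) \<le> ennreal N / ennreal D"
  proof (cases "D = 0")
    case False
    then have D0: "D > 0" using D(2) by simp
    \<comment> \<open>The factor n^-2 from the width of the peak cancels the n^-2 from the distance
      to the level curve, leaving growth of order n^p.\<close>
    have "(real n / 21952) powr p / (64 * C) = (real n / 21952) powr p / (64 * real n ^ 2) / (C / real n ^ 2)"
      using n0 C by (simp add: field_simps)
    also have "\<dots> \<le> N / D"
      using N D D0 \<open>0 < N\<close> by (intro frac_le) auto
    finally show ?thesis
      using D0 \<open>0 < N\<close> by (simp add: divide_ennreal ennreal_leI)
  qed (use \<open>0 < N\<close> in simp)
  also have "\<dots> = mz_quotient p n P"
    by (simp add: mz_quotient_def N_def D_def)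
  also have "\<dots> \<le> Sup (mz_quotients p n)"
  proof (rule Sup_upper)
    have "P \<noteq> 0" using P(2) by auto
    then show "mz_quotient p n P \<in> mz_quotients p n"
      using P(1) unfolding mz_quotients_def by blast
  qed
  finally show ?thesis .
qed

theorem theorem2:
  fixes p :: real
  assumes "1 < p"
  shows "(\<forall>n. Sup (mz_quotients p n) \<in> mz_quotients p n) \<and>
         limsup (\<lambda>n. Sup (mz_quotients p n)) = \<infinity>"
proof
  show "\<forall>n. Sup (mz_quotients p n) \<in> mz_quotients p n"
    using Sup_mz_quotients_attained[OF assms] by blast
  obtain C J where C: "0 < C" and dist:
    "\<And>j n. j \<ge> J \<Longrightarrow> n = 6 * j + 2 \<Longrightarrow> infdist (fejer n (2 * j)) (level_curve n) \<le> C / real n ^ 2"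
    by (rule infdist_fejer_near_tip) blast
  \<comment> \<open>Along this subsequence n + 1 is three times an odd number; its limsup bounds the
    full limsup from below.\<close>
  define r where "r = (\<lambda>j::nat. 6 * j + 2)"
  define f where "f = (\<lambda>j. (real (r j) / 21952) powr p / (64 * C))"
  have le: "\<forall>\<^sub>F j in sequentially. ennreal (f j) \<le> ((\<lambda>n. Sup (mz_quotients p n)) \<circ> r) j"
    using eventually_ge_at_top[of "max J 2"]
  proof eventually_elim
    case (elim j)
    then have j: "2 \<le> j" "J \<le> j" by auto
    show ?case
    proof (cases "inj_on (fejer (r j)) {0..r j}")
      case True
      show ?thesis
        using mz_quotient_lagrange_ge[OF assms j(1) refl C dist[OF j(2) refl]] True
        by (simp add: f_def r_def)
    next
      case False
      show ?thesis
        unfolding o_def Sup_mz_quotients_coincident[OF assms False] by simp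
    qed
  qed
  have "filterlim f at_top sequentially"
    unfolding f_def r_def using C assms by real_asymp
  then have "((\<lambda>j. ennreal (f j)) \<longlongrightarrow> top) sequentially"
    by (simp add: ennreal_tendsto_top_eq_at_top)
  then have "limsup (\<lambda>j. ennreal (f j)) = top"
    by (intro lim_imp_Limsup) auto
  moreover have "limsup (\<lambda>j. ennreal (f j)) \<le> limsup ((\<lambda>n. Sup (mz_quotients p n)) \<circ> r)"
    using le by (rule Limsup_mono)
  moreover have "\<dots> \<le> limsup (\<lambda>n. Sup (mz_quotients p n))"
    by (rule limsup_subseq_mono) (simp add: r_def strict_mono_def)
  ultimately show "limsup (\<lambda>n. Sup (mz_quotients p n)) = \<infinity>"
    by (simp add: top_unique)
qed

end
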